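(* Let $k\in\mathbb{N}$, $k\ge 1$, let $p_1,\dots,p_k\in\mathbb{N}$ and let $x\in[0,1)$. Then, as $N\to\infty$ (along $N$ large enough that $\lfloor xN\rfloor+k\le N$), $$\mathbb{E}\Big[\prod_{j=1}^k \eta_{\lfloor xN\rfloor+j,N}^{\,p_j}\Big]\ \longrightarrow\ \prod_{j=1}^k \mathbb{E}\big[\eta_{1,1}^{p_j}\,\big|\,\Theta_{1,1}=\rho_{\theta_L,\theta_R}(x)\big]=\prod_{j=1}^k\int \xi^{p_j}\,d\nu_{\rho_{\theta_L,\theta_R}(x)}(\xi).$$
   Context: $\mathbb{N}=\{0,1,2,\dots\}$, and $0^0=1$. For $\theta\in[0,\infty)$, $\nu_\theta$ is the geometric distribution on $\mathbb{N}$ with mean $\theta$: $\nu_\theta(n)=\frac{1}{1+\theta}\big(\frac{\theta}{1+\theta}\big)^n$. Fix $0\le\theta_L<\theta_R$ and set $\rho_{\theta_L,\theta_R}(x)=\theta_L+(\theta_R-\theta_L)x$ for $x\in[0,1]$. For each $N\ge1$, let $\Theta=(\Theta_{1,N},\dots,\Theta_{N,N})$ be the order statistics ($\Theta_{1,N}\le\dots\le\Theta_{N,N}$) of $N$ independent random variables uniformly distributed on $[\theta_L,\theta_R]$. The random configuration $\eta=(\eta_{1,N},\dots,\eta_{N,N})\in\mathbb{N}^N$ is such that, conditionally on $\Theta=(\theta_1,\dots,\theta_N)$, its law is the product measure $\otimes_{i=1}^N\nu_{\theta_i}$; the unconditional law $\mu_N$ of $\eta$ is thus the mixture $\mu_N=\mathbb{E}[\otimes_{i=1}^N\nu_{\Theta_{i,N}}]$.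 Expectations conditional on $\Theta_{1,1}=\theta$ are expectations under $\nu_\theta$. *)

theory Defs
  imports "HOL-Probability.Probability" "HOL-Real_Asymp.Real_Asymp"
begin

text \<open>The library's geometric distribution is parametrized by the success probability, here
  \<open>1 / (1 + \<theta>)\<close>, and counts failures. Parameters \<open>\<theta> < 0\<close> have probability zero below; they are
  given an arbitrary fixed value because \<^const>\<open>geometric_pmf\<close> is unspecified there and
  the mixing kernel has to be measurable on the whole space.\<close>

definition geom_law :: "real \<Rightarrow> nat pmf" where
  "geom_law \<theta> = (if 0 \<le> \<theta> then geometric_pmf (1 / (1 + \<theta>)) else return_pmf 0)"

lemma pmf_geom_law:
  assumes "0 \<le> \<theta>"
  shows "pmf (geom_law \<theta>) n = 1 / (1 + \<theta>) * (\<theta> / (1 + \<theta>)) ^ n"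
proof -
  have "1 - 1 / (1 + \<theta>) = \<theta> / (1 + \<theta>)"
    using assms by (simp add: field_simps)
  then show ?thesis
    using assms by (simp add: geom_law_def)
qed

lemma expectation_geom_law:
  assumes "0 \<le> \<theta>"
  shows "measure_pmf.expectation (geom_law \<theta>) real = \<theta>"
  using assms by (simp add: geom_law_def expectation_geometric_pmf field_simps)

lemma integrable_geom_law_power:
  assumes "0 \<le> \<theta>"
  shows "integrable (measure_pmf (geom_law \<theta>)) (\<lambda>n. real n ^ p)"
proof -
  define r where "r = \<theta> / (1 + \<theta>)"
  have r: "0 \<le> r" "r < 1" using assms by (auto simp: r_def)
  have "summable (\<lambda>n. real n ^ p * r ^ n)"
  proof (cases "r = 0")
    case True
    have "summable (\<lambda>n. if n = 0 then real n ^ p else 0)"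
      by (rule summable_finite[of "{0}"]) auto
    moreover have "(\<lambda>n. real n ^ p * r ^ n) = (\<lambda>n. if n = 0 then real n ^ p else 0)"
      using True by (auto simp: fun_eq_iff)
    ultimately show ?thesis by simp
  next
    case False
    with r have r': "0 < r" "r < 1" by auto
    have "summable (\<lambda>n. 1 / real n ^ 2)"
      using inverse_power_summable[of 2, where ?'a = real] by (simp add: inverse_eq_divide)
    then have "summable (\<lambda>n. norm (1 / real n ^ 2))" by simp
    moreover have "(\<lambda>n. real n ^ p * r ^ n) \<in> O(\<lambda>n. 1 / real n ^ 2)"
      using r' by real_asymp
    ultimately show ?thesis
      by (rule summable_comparison_test_bigo)
  qed
  then have "summable (\<lambda>n. 1 / (1 + \<theta>) * (real n ^ p * r ^ n))"
    by (rule summable_mult)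
  moreover have "norm (pmf (geom_law \<theta>) n *\<^sub>R real n ^ p) = 1 / (1 + \<theta>) * (real n ^ p * r ^ n)" for n
  proof -
    have "pmf (geom_law \<theta>) n *\<^sub>R real n ^ p = 1 / (1 + \<theta>) * (real n ^ p * r ^ n)"
      using assms by (simp only: pmf_geom_law r_def real_scaleR_def mult_ac)
    moreover have "0 \<le> 1 / (1 + \<theta>) * (real n ^ p * r ^ n)"
      using assms r by simp
    ultimately show ?thesis by (simp only: real_norm_def abs_of_nonneg)
  qed
  ultimately show ?thesis
    unfolding measure_pmf_eq_density
    by (subst integrable_density) (simp_all only: integrable_count_space_nat_iff, auto)
qed

definition linear_profile :: "real \<Rightarrow> real \<Rightarrow> real \<Rightarrow> real" where
  "linear_profile \<theta>\<^sub>L \<theta>\<^sub>R x = \<theta>\<^sub>L + (\<theta>\<^sub>R - \<theta>\<^sub>L) * x"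

text \<open>\<open>order_stat N u i\<close> is the \<open>i\<close>-th smallest, \<open>1 \<le> i \<le> N\<close>, of \<open>u 1, \<dots>, u N\<close>, counted
  with multiplicity.\<close>

definition order_stat :: "nat \<Rightarrow> (nat \<Rightarrow> real) \<Rightarrow> nat \<Rightarrow> real" where
  "order_stat N u i = sort (map u [1..<Suc N]) ! (i - 1)"

definition iid_uniform :: "real \<Rightarrow> real \<Rightarrow> nat \<Rightarrow> (nat \<Rightarrow> real) measure" where
  "iid_uniform \<theta>\<^sub>L \<theta>\<^sub>R N = (\<Pi>\<^sub>M i\<in>{1..N}. uniform_measure lborel {\<theta>\<^sub>L..\<theta>\<^sub>R})"

definition geom_product :: "nat \<Rightarrow> (nat \<Rightarrow> real) \<Rightarrow> (nat \<Rightarrow> nat) measure" where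
  "geom_product N \<theta> = (\<Pi>\<^sub>M i\<in>{1..N}. measure_pmf (geom_law (\<theta> i)))"

definition geom_mixture :: "real \<Rightarrow> real \<Rightarrow> nat \<Rightarrow> (nat \<Rightarrow> nat) measure" where
  "geom_mixture \<theta>\<^sub>L \<theta>\<^sub>R N =
     iid_uniform \<theta>\<^sub>L \<theta>\<^sub>R N \<bind> (\<lambda>u. geom_product N (order_stat N u))"

text \<open>The bind of measures is only meaningful for a measurable kernel; the following lemmas
  establish this, and that the mixture is a probability measure.\<close>

lemma sorted_nth_le_iff:
  fixes xs :: "real list"
  assumes "sorted xs" "i < length xs"
  shows "xs ! i \<le> c \<longleftrightarrow> i < card {j. j < length xs \<and> xs ! j \<le> c}"
proof
  assume le: "xs ! i \<le> c"
  have "{..i} \<subseteq> {j. j < length xs \<and> xs ! j \<le> c}"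
  proof
    fix j assume "j \<in> {..i}"
    then have "xs ! j \<le> xs ! i"
      using assms by (auto intro: sorted_nth_mono)
    with le \<open>j \<in> {..i}\<close> assms(2) show "j \<in> {j. j < length xs \<and> xs ! j \<le> c}" by auto
  qed
  then have "card {..i} \<le> card {j. j < length xs \<and> xs ! j \<le> c}"
    by (intro card_mono) auto
  then show "i < card {j. j < length xs \<and> xs ! j \<le> c}" by simp
next
  assume less: "i < card {j. j < length xs \<and> xs ! j \<le> c}"
  show "xs ! i \<le> c"
  proof (rule ccontr)
    assume *: "\<not> xs ! i \<le> c"
    have "{j. j < length xs \<and> xs ! j \<le> c} \<subseteq> {..<i}"
    proof
      fix j assume j: "j \<in> {j. j < length xs \<and> xs ! j \<le> c}"
      show "j \<in> {..<i}"
      proof (rule ccontr)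
        assume "j \<notin> {..<i}"
        then have "xs ! i \<le> xs ! j"
          using j assms by (intro sorted_nth_mono) auto
        with j * show False by auto
      qed
    qed
    then have "card {j. j < length xs \<and> xs ! j \<le> c} \<le> card {..<i}"
      by (intro card_mono) auto
    with less show False by simp
  qed
qed

lemma order_stat_le_iff:
  assumes "i \<in> {1..N}"
  shows "order_stat N u i \<le> c \<longleftrightarrow> i \<le> card {j\<in>{1..N}. u j \<le> c}"
proof -
  let ?xs = "map u [1..<Suc N]"
  have "card {j. j < length (sort ?xs) \<and> sort ?xs ! j \<le> c} = length (filter (\<lambda>y. y \<le> c) (sort ?xs))"
    by (simp add: length_filter_conv_card)
  also have "\<dots> = length (filter (\<lambda>y. y \<le> c) ?xs)"
    by (metis mset_filter mset_sort size_mset)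
  also have "\<dots> = length (filter (\<lambda>j. u j \<le> c) [1..<Suc N])"
    by (simp add: filter_map o_def del: upt_Suc)
  also have "\<dots> = card (set (filter (\<lambda>j. u j \<le> c) [1..<Suc N]))"
    by (rule distinct_card[symmetric]) (simp del: upt_Suc)
  also have "set (filter (\<lambda>j. u j \<le> c) [1..<Suc N]) = {j\<in>{1..N}. u j \<le> c}"
    by (auto simp del: upt_Suc)
  finally have card: "card {j. j < length (sort ?xs) \<and> sort ?xs ! j \<le> c}
      = card {j\<in>{1..N}. u j \<le> c}" .
  have "order_stat N u i \<le> c \<longleftrightarrow> i - 1 < card {j. j < length (sort ?xs) \<and> sort ?xs ! j \<le> c}"
    unfolding order_stat_def using assms
    by (intro sorted_nth_le_iff) (auto simp del: upt_Suc)
  then show ?thesis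
    using assms unfolding card by auto
qed

lemma measurable_order_stat:
  assumes "i \<in> {1..N}"
  shows "(\<lambda>u. order_stat N u i) \<in> borel_measurable (\<Pi>\<^sub>M i\<in>{1..N}. borel)"
proof (rule borel_measurableI_le)
  fix c :: real
  let ?M = "\<Pi>\<^sub>M i\<in>{1..N}. (borel :: real measure)"
  have eq: "real (card {j\<in>{1..N}. u j \<le> c}) = (\<Sum>j\<in>{1..N}. indicator {..c} (u j))" for u :: "nat \<Rightarrow> real"
  proof -
    have "(\<Sum>j\<in>{1..N}. indicator {..c} (u j)) = (\<Sum>j\<in>{1..N}. if u j \<le> c then 1 else 0 :: real)"
      by (intro sum.cong) (auto simp: indicator_def)
    also have "\<dots> = real (card ({1..N} \<inter> {j. u j \<le> c}))"
      by (simp add: sum.If_cases)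
    also have "{1..N} \<inter> {j. u j \<le> c} = {j\<in>{1..N}. u j \<le> c}" by auto
    finally show ?thesis ..
  qed
  have "{u \<in> space ?M. order_stat N u i \<le> c}
      = {u \<in> space ?M. real i \<le> (\<Sum>j\<in>{1..N}. indicator {..c} (u j))}"
    using order_stat_le_iff[OF assms] eq[symmetric] by auto
  also have "\<dots> \<in> sets ?M" by measurable
  finally show "{u \<in> space ?M. order_stat N u i \<le> c} \<in> sets ?M" .
qed

lemma measurable_emeasure_geom_law:
  "(\<lambda>\<theta>. emeasure (measure_pmf (geom_law \<theta>)) A) \<in> borel_measurable borel"
proof -
  have pmf: "(\<lambda>\<theta>. pmf (geom_law \<theta>) n) \<in> borel_measurable borel" for n
  proof -
    have "(\<lambda>\<theta>. pmf (geom_law \<theta>) n)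
      = (\<lambda>\<theta>. if 0 \<le> \<theta> then 1 / (1 + \<theta>) * (\<theta> / (1 + \<theta>)) ^ n else pmf (return_pmf 0) n)"
      by (auto simp: fun_eq_iff pmf_geom_law) (simp add: geom_law_def)
    then show ?thesis by simp
  qed
  have "emeasure (measure_pmf (geom_law \<theta>)) A
      = (\<Sum>n. ennreal (pmf (geom_law \<theta>) n) * indicator A n)" for \<theta>
  proof -
    have "emeasure (measure_pmf (geom_law \<theta>)) A = (\<integral>\<^sup>+n. indicator A n \<partial>measure_pmf (geom_law \<theta>))"
      by simp
    also have "\<dots> = (\<integral>\<^sup>+n. ennreal (pmf (geom_law \<theta>) n) * indicator A n \<partial>count_space UNIV)"
      by (rule nn_integral_measure_pmf)
    finally show ?thesis by (simp add: nn_integral_count_space_nat)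
  qed
  then show ?thesis using pmf by simp
qed

lemma prob_space_geom_product: "prob_space (geom_product N \<theta>)"
  unfolding geom_product_def by (intro prob_space_PiM measure_pmf.prob_space_axioms)

lemma measurable_geom_product:
  "(\<lambda>u. geom_product N (order_stat N u))
     \<in> (\<Pi>\<^sub>M i\<in>{1..N}. borel) \<rightarrow>\<^sub>M prob_algebra (\<Pi>\<^sub>M i\<in>{1..N}. count_space UNIV)"
proof (rule measurable_prob_algebra_generated[where \<Omega> = "\<Pi>\<^sub>E i\<in>{1..N}. UNIV"
      and G = "prod_algebra {1..N} (\<lambda>_. count_space (UNIV :: nat set))"])
  show "sets (\<Pi>\<^sub>M i\<in>{1..N}. count_space (UNIV :: nat set))
      = sigma_sets (\<Pi>\<^sub>E i\<in>{1..N}. UNIV) (prod_algebra {1..N} (\<lambda>_. count_space UNIV))"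
    by (simp add: sets_PiM)
  show "Int_stable (prod_algebra {1..N} (\<lambda>_. count_space (UNIV :: nat set)))"
    by (rule Int_stable_prod_algebra)
  show "prod_algebra {1..N} (\<lambda>_. count_space (UNIV :: nat set)) \<subseteq> Pow (\<Pi>\<^sub>E i\<in>{1..N}. UNIV)"
    using prod_algebra_sets_into_space[of "{1..N}" "\<lambda>_. count_space (UNIV :: nat set)"] by simp
  show "prob_space (geom_product N (order_stat N u))" for u
    by (rule prob_space_geom_product)
  show "sets (geom_product N (order_stat N u)) = sets (\<Pi>\<^sub>M i\<in>{1..N}. count_space UNIV)" for u
    unfolding geom_product_def by (intro sets_PiM_cong) auto
  fix A assume "A \<in> prod_algebra {1..N} (\<lambda>_. count_space (UNIV :: nat set))"
  then obtain X where A: "A = (\<Pi>\<^sub>E i\<in>{1..N}. X i)"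
    by (subst (asm) prod_algebra_eq_finite) auto
  have "emeasure (geom_product N \<theta>) A = (\<Prod>i\<in>{1..N}. emeasure (measure_pmf (geom_law (\<theta> i))) (X i))" for \<theta>
  proof -
    interpret product_prob_space "\<lambda>i. measure_pmf (geom_law (\<theta> i))" "{1..N}"
      by (simp add: product_prob_space_def product_sigma_finite_def product_prob_space_axioms_def
          measure_pmf.prob_space_axioms measure_pmf.sigma_finite_measure_axioms)
    show ?thesis unfolding geom_product_def A by (intro emeasure_PiM) auto
  qed
  moreover have "(\<lambda>u. emeasure (measure_pmf (geom_law (order_stat N u i))) (X i))
      \<in> borel_measurable (\<Pi>\<^sub>M i\<in>{1..N}. borel)" if "i \<in> {1..N}" for i
    using measurable_compose[OF measurable_order_stat[OF that] measurable_emeasure_geom_law] .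
  ultimately show "(\<lambda>u. emeasure (geom_product N (order_stat N u)) A)
      \<in> borel_measurable (\<Pi>\<^sub>M i\<in>{1..N}. borel)"
    by (simp add: borel_measurable_prod_ennreal)
qed

lemma geom_mixture_in_prob_algebra:
  assumes "\<theta>\<^sub>L < \<theta>\<^sub>R"
  shows "geom_mixture \<theta>\<^sub>L \<theta>\<^sub>R N \<in> space (prob_algebra (\<Pi>\<^sub>M i\<in>{1..N}. count_space UNIV))"
proof -
  have "prob_space (uniform_measure lborel {\<theta>\<^sub>L..\<theta>\<^sub>R})"
    using assms by (intro prob_space_uniform_measure) auto
  then have "prob_space (iid_uniform \<theta>\<^sub>L \<theta>\<^sub>R N)"
    unfolding iid_uniform_def by (intro prob_space_PiM)
  moreover have "sets (iid_uniform \<theta>\<^sub>L \<theta>\<^sub>R N) = sets (\<Pi>\<^sub>M i\<in>{1..N}. borel)"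
    unfolding iid_uniform_def by (intro sets_PiM_cong) auto
  ultimately have "iid_uniform \<theta>\<^sub>L \<theta>\<^sub>R N \<in> space (prob_algebra (\<Pi>\<^sub>M i\<in>{1..N}. borel))"
    by (simp add: space_prob_algebra)
  then show ?thesis
    unfolding geom_mixture_def space_prob_algebra
    using prob_space_bind'[OF _ measurable_geom_product, of "iid_uniform \<theta>\<^sub>L \<theta>\<^sub>R N" N]
      sets_bind'[OF _ measurable_geom_product, of "iid_uniform \<theta>\<^sub>L \<theta>\<^sub>R N" N]
    by (simp add: space_prob_algebra)
qed

end

theory Submission
  imports Defs
begin

text \<open>Integrating out \<open>\<eta>\<close> first turns the expectation into that of
  \<open>\<Prod>j. geom_moment (p j) (\<Theta> (\<lfloor>xN\<rfloor> + j))\<close>, where \<open>\<Theta>\<close> are the uniform order statistics and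
  \<open>geom_moment q\<close> is continuous, as a rational function times a power series in
  \<open>\<theta> / (1 + \<theta>) < 1\<close>. An order statistic of rank \<open>i\<close> exceeds \<open>c\<close> iff fewer than \<open>i\<close> of the samples
  are at most \<open>c\<close>, so Hoeffding's inequality for these counts makes the order statistics of rank
  \<open>\<lfloor>xN\<rfloor> + j\<close> converge in probability to the profile at \<open>x\<close>; the integrand is bounded because
  \<open>\<Theta>\<close> ranges over a compact interval.\<close>

subsection \<open>Moments of the geometric distribution\<close>

definition geom_moment :: "nat \<Rightarrow> real \<Rightarrow> real" where
  "geom_moment p \<theta> = measure_pmf.expectation (geom_law \<theta>) (\<lambda>n. real n ^ p)"

text \<open>For negative \<open>\<theta>\<close> the law is a point mass at \<open>0\<close>. The
  absence of a sign condition lets the moment identities be used under the mixing kernel for every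
  sample \<open>u\<close>.\<close>

lemma integrable_geom_law_power_any: "integrable (measure_pmf (geom_law \<theta>)) (\<lambda>n. real n ^ p)"
proof (cases "0 \<le> \<theta>")
  case True
  then show ?thesis by (rule integrable_geom_law_power)
next
  case False
  then show ?thesis
    by (simp add: geom_law_def) (rule integrable_measure_pmf_finite, simp)
qed

lemma geom_moment_nonneg: "0 \<le> geom_moment p \<theta>"
  unfolding geom_moment_def by (intro Bochner_Integration.integral_nonneg) simp

lemma nn_integral_geom_law_power:
  "(\<integral>\<^sup>+n. ennreal (real n ^ p) \<partial>measure_pmf (geom_law \<theta>)) = ennreal (geom_moment p \<theta>)"
  unfolding geom_moment_def
  by (intro nn_integral_eq_integral integrable_geom_law_power_any) simp

text \<open>Exponential decay beats every power, so the terms are \<open>O(1 / n^2)\<close>.\<close>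

lemma summable_power_times_geometric:
  fixes r :: real
  assumes "0 < r" "r < 1"
  shows "summable (\<lambda>n. real n ^ p * r ^ n)"
proof (rule summable_comparison_test_bigo)
  show "summable (\<lambda>n. norm (1 / real n ^ 2))"
    using inverse_power_summable[of 2, where ?'a = real] by (simp add: inverse_eq_divide)
  show "(\<lambda>n. real n ^ p * r ^ n) \<in> O(\<lambda>n. 1 / real n ^ 2)"
    using assms by real_asymp
qed

text \<open>Makes continuity in \<open>\<theta>\<close> accessible: the expectation becomes a power
  series in the ratio \<open>\<theta> / (1 + \<theta>)\<close>.\<close>

lemma geom_moment_eq:
  assumes "0 \<le> \<theta>"
  shows "geom_moment p \<theta> = (\<Sum>n. real n ^ p * (\<theta> / (1 + \<theta>)) ^ n) / (1 + \<theta>)"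
proof -
  have int: "integrable (count_space UNIV) (\<lambda>n. pmf (geom_law \<theta>) n *\<^sub>R real n ^ p)"
    using integrable_geom_law_power_any[of \<theta> p]
    unfolding measure_pmf_eq_density by (subst (asm) integrable_density) auto
  have "geom_moment p \<theta> = (\<integral>n. pmf (geom_law \<theta>) n *\<^sub>R real n ^ p \<partial>count_space UNIV)"
    unfolding geom_moment_def measure_pmf_eq_density by (subst integral_density) auto
  also have "\<dots> = (\<Sum>n. pmf (geom_law \<theta>) n *\<^sub>R real n ^ p)"
    by (rule integral_count_space_nat[OF int])
  also have "\<dots> = (\<Sum>n. (real n ^ p * (\<theta> / (1 + \<theta>)) ^ n) / (1 + \<theta>))"
    using assms by (simp add: pmf_geom_law mult_ac)
  also have "\<dots> = (\<Sum>n. real n ^ p * (\<theta> / (1 + \<theta>)) ^ n) / (1 + \<theta>)"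
  proof (rule suminf_divide)
    show "summable (\<lambda>n. real n ^ p * (\<theta> / (1 + \<theta>)) ^ n)"
    proof (cases "\<theta> = 0")
      \<comment> \<open>Ratio \<open>0\<close> lies outside the range of
        \<open>summable_power_times_geometric\<close>; only the term \<open>n = 0\<close> can be
        nonzero.\<close>
      case True
      then show ?thesis
        by (intro summable_finite[of "{0}"]) auto
    qed (use assms in \<open>auto intro!: summable_power_times_geometric\<close>)
  qed
  finally show ?thesis .
qed

text \<open>The power series converges on \<open>[0,1)\<close>, and
  \<open>\<theta> / (1 + \<theta>)\<close> maps the closed half-line into that interval.\<close>

lemma continuous_on_geom_moment: "continuous_on {0..} (geom_moment p)"
proof -
  have "continuous_on {0..<1} (\<lambda>r::real. \<Sum>n. real n ^ p * r ^ n)"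
  proof (intro continuous_at_imp_continuous_on ballI)
    fix r :: real assume "r \<in> {0..<1}"
    \<comment> \<open>The midpoint of \<open>r\<close> and \<open>1\<close> is positive even for
      \<open>r = 0\<close>, lies in the region of convergence and exceeds \<open>r\<close>.\<close>
    then show "isCont (\<lambda>r. \<Sum>n. real n ^ p * r ^ n) r"
      by (intro isCont_powser[where K = "(1 + r) / 2"] summable_power_times_geometric) auto
  qed
  then have "continuous_on {0..} (\<lambda>\<theta>::real. \<Sum>n. real n ^ p * (\<theta> / (1 + \<theta>)) ^ n)"
    by (rule continuous_on_compose2) (auto intro!: continuous_intros)
  then have "continuous_on {0..} (\<lambda>\<theta>. (\<Sum>n. real n ^ p * (\<theta> / (1 + \<theta>)) ^ n) / (1 + \<theta>))"
    by (auto intro!: continuous_intros)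
  then show ?thesis
    by (rule continuous_on_eq) (simp add: geom_moment_eq)
qed

lemma borel_measurable_geom_moment [measurable]: "geom_moment p \<in> borel_measurable borel"
proof -
  \<comment> \<open>\<open>0 ^ p\<close> is the moment of the point mass at \<open>0\<close>, the
    default law for negative parameters.\<close>
  have "geom_moment p = (\<lambda>\<theta>. if \<theta> \<in> {0..} then geom_moment p \<theta> else 0 ^ p)"
    by (auto simp: fun_eq_iff geom_moment_def geom_law_def)
  moreover have "\<dots> \<in> borel_measurable borel"
    by (rule borel_measurable_continuous_on_if) (auto intro: continuous_on_geom_moment)
  ultimately show ?thesis by simp
qed

subsection \<open>Bounded functions converging in probability\<close>

text \<open>Joint continuity at the diagonal point \<open>(r, ..., r)\<close>, by sequences: tuples
  violating the claim for \<open>\<delta> = 1 / (n + 1)\<close> converge to \<open>r\<close> in each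
  coordinate, so their products converge to the product at \<open>r\<close>.\<close>

lemma prod_continuous_on_uniform:
  fixes f :: "'a \<Rightarrow> real \<Rightarrow> real"
  assumes fin: "finite A" and cont: "\<And>j. j \<in> A \<Longrightarrow> continuous_on S (f j)"
    and r: "r \<in> S" and \<epsilon>: "0 < \<epsilon>"
  shows "\<exists>\<delta>>0. \<forall>t. (\<forall>j\<in>A. t j \<in> S \<and> \<bar>t j - r\<bar> \<le> \<delta>) \<longrightarrow>
    \<bar>(\<Prod>j\<in>A. f j (t j)) - (\<Prod>j\<in>A. f j r)\<bar> \<le> \<epsilon>"
proof (rule ccontr)
  assume *: "\<not> ?thesis"
  have "\<exists>t. (\<forall>j\<in>A. t j \<in> S \<and> \<bar>t j - r\<bar> \<le> 1 / real (Suc n)) \<and>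
      \<not> \<bar>(\<Prod>j\<in>A. f j (t j)) - (\<Prod>j\<in>A. f j r)\<bar> \<le> \<epsilon>" for n
    using *[simplified not_ex de_Morgan_conj, rule_format, of "1 / real (Suc n)"] by fastforce
  then obtain t where t: "\<And>n j. j \<in> A \<Longrightarrow> t n j \<in> S"
      "\<And>n j. j \<in> A \<Longrightarrow> \<bar>t n j - r\<bar> \<le> 1 / real (Suc n)"
      "\<And>n. \<not> \<bar>(\<Prod>j\<in>A. f j (t n j)) - (\<Prod>j\<in>A. f j r)\<bar> \<le> \<epsilon>"
    by metis
  have "(\<lambda>n. t n j) \<longlonglongrightarrow> r" if "j \<in> A" for j
  proof (rule LIM_zero_cancel, rule Lim_null_comparison)
    show "eventually (\<lambda>n. norm (t n j - r) \<le> 1 / real (Suc n)) sequentially"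
      using t(2)[OF that] by simp
    show "(\<lambda>n. 1 / real (Suc n)) \<longlonglongrightarrow> 0"
      by real_asymp
  qed
  then have "(\<lambda>n. f j (t n j)) \<longlonglongrightarrow> f j r" if "j \<in> A" for j
    using continuous_on_tendsto_compose[OF cont[OF that], of "\<lambda>n. t n j" r sequentially] that r t(1)
    by simp
  then have "(\<lambda>n. \<Prod>j\<in>A. f j (t n j)) \<longlonglongrightarrow> (\<Prod>j\<in>A. f j r)"
    by (rule tendsto_prod)
  then have "eventually (\<lambda>n. dist (\<Prod>j\<in>A. f j (t n j)) (\<Prod>j\<in>A. f j r) < \<epsilon>) sequentially"
    using \<epsilon> by (rule tendstoD)
  then show False
    using t(3) by (auto simp: dist_real_def eventually_sequentially intro: less_imp_le)
qed

text \<open>The underlying space changes with \<open>N\<close>, so the integral is split by hand: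
  off \<open>B N\<close> the error is at most \<open>\<epsilon>\<close>, and on \<open>B N\<close> a
  bounded error is weighted by a vanishing probability.\<close>

lemma tendsto_integral_bounded_in_probability:
  fixes f :: "nat \<Rightarrow> 'a \<Rightarrow> real" and M :: "nat \<Rightarrow> 'a measure"
  assumes M: "\<And>N. prob_space (M N)"
    and meas: "eventually (\<lambda>N. f N \<in> borel_measurable (M N)) sequentially"
    and bound: "eventually (\<lambda>N. AE u in M N. \<bar>f N u\<bar> \<le> C) sequentially"
    and conv: "\<And>\<epsilon>. 0 < \<epsilon> \<Longrightarrow> \<exists>B. (\<forall>N. B N \<in> sets (M N)) \<and> (\<lambda>N. measure (M N) (B N)) \<longlonglongrightarrow> 0 \<and>
        eventually (\<lambda>N. AE u in M N. u \<notin> B N \<longrightarrow> \<bar>f N u - L\<bar> \<le> \<epsilon>) sequentially"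
  shows "(\<lambda>N. \<integral>u. f N u \<partial>M N) \<longlonglongrightarrow> L"
proof (rule LIMSEQ_I)
  fix e :: real assume e: "0 < e"
  \<comment> \<open>Bounds \<open>\<bar>f N u - L\<bar>\<close> on the exceptional set; the other
    half of the error \<open>e\<close> is spent off it.\<close>
  define K where "K = \<bar>C\<bar> + \<bar>L\<bar>"
  obtain B where B: "\<And>N. B N \<in> sets (M N)" "(\<lambda>N. measure (M N) (B N)) \<longlonglongrightarrow> 0"
      and close: "eventually (\<lambda>N. AE u in M N. u \<notin> B N \<longrightarrow> \<bar>f N u - L\<bar> \<le> e / 2) sequentially"
    using conv[of "e / 2"] e by auto
  have "(\<lambda>N. e / 2 + K * measure (M N) (B N)) \<longlonglongrightarrow> e / 2 + K * 0"
    by (intro tendsto_intros B)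
  then have "eventually (\<lambda>N. e / 2 + K * measure (M N) (B N) < e) sequentially"
    by (rule order_tendstoD) (use e in simp)
  with meas bound close have "eventually (\<lambda>N. norm ((\<integral>u. f N u \<partial>M N) - L) < e) sequentially"
  proof eventually_elim
    case (elim N)
    interpret prob_space "M N" by (rule M)
    have [measurable]: "f N \<in> borel_measurable (M N)" "B N \<in> sets (M N)" using elim B by auto
    have int: "integrable (M N) (f N)"
      using elim by (intro integrable_const_bound[where B = C]) auto
    have [simp]: "integrable (M N) (indicator (B N) :: 'a \<Rightarrow> real)"
      by (rule integrable_real_indicator) (auto simp: less_top[symmetric])
    have "norm ((\<integral>u. f N u \<partial>M N) - L) = norm (\<integral>u. f N u - L \<partial>M N)"
      using int by (simp add: prob_space)
    also have "\<dots> \<le> (\<integral>u. norm (f N u - L) \<partial>M N)"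
      by (rule integral_norm_bound)
    also have "\<dots> \<le> (\<integral>u. e / 2 + K * indicator (B N) u \<partial>M N)"
    proof (rule integral_mono_AE)
      show "AE u in M N. norm (f N u - L) \<le> e / 2 + K * indicator (B N) u"
        using elim(2) elim(3) by eventually_elim (use e in \<open>auto simp: K_def indicator_def\<close>)
    qed (use int in auto)
    also have "\<dots> = e / 2 + K * measure (M N) (B N)"
      by (simp add: prob_space)
    finally show ?case using elim by simp
  qed
  then show "\<exists>n0. \<forall>n\<ge>n0. norm ((\<integral>u. f n u \<partial>M n) - L) < e"
    by (simp add: eventually_sequentially)
qed

subsection \<open>Concentration of uniform order statistics\<close>

text \<open>Both bounds come from counting: all \<open>N\<close> samples are at most
  \<open>b\<close>, and an order statistic below \<open>a\<close> would have no sample at or below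
  it, although its rank demands at least \<open>i \<ge> 1\<close>.\<close>

lemma order_stat_in_Icc:
  assumes u: "\<And>j. j \<in> {1..N} \<Longrightarrow> u j \<in> {a..b}" and i: "i \<in> {1..N}"
  shows "order_stat N u i \<in> {a..b}"
proof -
  have "{j \<in> {1..N}. u j \<le> b} = {1..N}" using u by auto
  then have "order_stat N u i \<le> b" using i order_stat_le_iff[OF i, of u b] by simp
  moreover have "a \<le> order_stat N u i"
  proof (rule ccontr)
    assume "\<not> a \<le> order_stat N u i"
    then have "{j \<in> {1..N}. u j \<le> order_stat N u i} = {}" using u by fastforce
    moreover have "i \<le> card {j \<in> {1..N}. u j \<le> order_stat N u i}"
      using order_stat_le_iff[OF i, of u "order_stat N u i"] by blast
    ultimately have "i \<le> 0" by (metis card.empty)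
    then show False using i by simp
  qed
  ultimately show ?thesis by simp
qed

section \<open>Range, marginals and independence of the uniform samples\<close>

lemma prob_space_uniform_Icc:
  fixes a b :: real
  assumes "a < b"
  shows "prob_space (uniform_measure lborel {a..b})"
  using assms by (intro prob_space_uniform_measure) auto

lemma prob_space_iid_uniform:
  assumes "a < b"
  shows "prob_space (iid_uniform a b N)"
  unfolding iid_uniform_def by (intro prob_space_PiM prob_space_uniform_Icc assms)

lemma sets_iid_uniform: "sets (iid_uniform a b N) = sets (\<Pi>\<^sub>M i\<in>{1..N}. borel)"
  unfolding iid_uniform_def by (intro sets_PiM_cong) auto

text \<open>Only almost sure, since the product space contains samples outside
  \<open>{a..b}\<close>.\<close>

lemma AE_iid_uniform_order_stat:
  assumes "a < b"
  shows "AE u in iid_uniform a b N. \<forall>i\<in>{1..N}. order_stat N u i \<in> {a..b}"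
proof -
  have "AE u in iid_uniform a b N. \<forall>j\<in>{1..N}. u j \<in> {a..b}"
    unfolding iid_uniform_def
  proof (intro eventually_ball_finite ballI AE_PiM_component prob_space_uniform_Icc assms)
    show "AE u in uniform_measure lborel {a..b}. u \<in> {a..b}"
      by (rule AE_uniform_measureI) auto
  qed auto
  then show ?thesis
    by eventually_elim (blast intro: order_stat_in_Icc)
qed

lemma measurable_iid_uniform_component:
  "j \<in> {1..N} \<Longrightarrow> (\<lambda>u. u j) \<in> borel_measurable (iid_uniform a b N)"
  unfolding measurable_cong_sets[OF sets_iid_uniform refl]
  by (rule measurable_component_singleton)

lemma distr_iid_uniform_component:
  assumes "a < b" "j \<in> {1..N}"
  shows "distr (iid_uniform a b N) borel (\<lambda>u. u j) = uniform_measure lborel {a..b}"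
proof -
  \<comment> \<open>Only the sigma-algebra of the target matters; \<open>distr_PiM_component\<close>
    is phrased with the factor itself as target.\<close>
  have "distr (iid_uniform a b N) borel (\<lambda>u. u j)
      = distr (iid_uniform a b N) (uniform_measure lborel {a..b}) (\<lambda>u. u j)"
    by (intro distr_cong) auto
  then show ?thesis
    unfolding iid_uniform_def
    by (simp only: distr_PiM_component[of "{1..N}" "\<lambda>_. uniform_measure lborel {a..b}" j,
          OF prob_space_uniform_Icc[OF assms(1)] assms(2)])
qed

text \<open>Independence means that the joint law is the product of the marginals. Here the joint
  map is the identity on extensional functions; the criterion asks for a nonempty index set, whence
  \<open>1 \<le> N\<close>.\<close>

lemma indep_vars_iid_uniform:
  assumes "a < b" "1 \<le> N"
  shows "prob_space.indep_vars (iid_uniform a b N) (\<lambda>_. borel) (\<lambda>j u. u j) {1..N}"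
proof -
  interpret prob_space "iid_uniform a b N" by (rule prob_space_iid_uniform[OF assms(1)])
  have "distr (iid_uniform a b N) (\<Pi>\<^sub>M i\<in>{1..N}. borel) (\<lambda>u. \<lambda>i\<in>{1..N}. u i)
      = distr (iid_uniform a b N) (iid_uniform a b N) (\<lambda>u. u)"
  proof (intro distr_cong sets_iid_uniform[symmetric] refl)
    fix u assume "u \<in> space (iid_uniform a b N)"
    then have "u \<in> extensional {1..N}" by (simp add: iid_uniform_def space_PiM PiE_def)
    then show "(\<lambda>i\<in>{1..N}. u i) = u" by (rule extensional_restrict)
  qed
  also have "\<dots> = iid_uniform a b N" by simp
  also have "\<dots> = (\<Pi>\<^sub>M i\<in>{1..N}. distr (iid_uniform a b N) borel (\<lambda>u. u i))"
    by (subst (1) iid_uniform_def) (intro PiM_cong refl distr_iid_uniform_component[symmetric] assms)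
  finally show ?thesis
    using assms(2)
    by (subst indep_vars_iff_distr_eq_PiM') (auto intro: measurable_iid_uniform_component)
qed

section \<open>Counts of samples below a level\<close>

lemma card_le_eq_sum_indicator:
  fixes u :: "nat \<Rightarrow> real"
  shows "real (card {j\<in>{1..N}. u j \<le> c}) = (\<Sum>j\<in>{1..N}. indicator {..c} (u j))"
proof -
  have "(\<Sum>j\<in>{1..N}. indicator {..c} (u j)) = (\<Sum>j\<in>{1..N}. if u j \<le> c then 1 else 0 :: real)"
    by (intro sum.cong) (auto simp: indicator_def)
  also have "\<dots> = real (card ({1..N} \<inter> {j. u j \<le> c}))"
    by (simp add: sum.If_cases)
  also have "{1..N} \<inter> {j. u j \<le> c} = {j\<in>{1..N}. u j \<le> c}" by auto
  finally show ?thesis ..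
qed

lemma sets_card_deviation:
  "{u \<in> space (iid_uniform a b N). r \<le> \<bar>real (card {j\<in>{1..N}. u j \<le> c}) - s\<bar>} \<in> sets (iid_uniform a b N)"
proof -
  have [measurable]: "(\<lambda>u. \<Sum>j\<in>{1..N}. indicator {..c} (u j) :: real) \<in> borel_measurable (iid_uniform a b N)"
    by (intro borel_measurable_sum measurable_compose[OF measurable_iid_uniform_component]) simp_all
  show ?thesis
    unfolding card_le_eq_sum_indicator by measurable
qed

text \<open>\<open>linear_profile a b\<close> is the quantile function of the uniform law, so the
  count is a sum of independent indicators of mean \<open>y\<close>, and Hoeffding's inequality
  gives an exponentially small bound.\<close>

lemma empirical_count_tendsto:
  assumes "a < b" "0 \<le> y" "y \<le> 1" "0 < \<epsilon>"
  shows "(\<lambda>N. measure (iid_uniform a b N) {u \<in> space (iid_uniform a b N).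
      \<epsilon> * real N \<le> \<bar>real (card {j\<in>{1..N}. u j \<le> linear_profile a b y}) - real N * y\<bar>}) \<longlonglongrightarrow> 0"
proof (rule Lim_null_comparison)
  let ?c = "linear_profile a b y"
  let ?X = "\<lambda>j u :: nat \<Rightarrow> real. indicator {..?c} (u j) :: real"
  have bound: "measure (iid_uniform a b N) {u \<in> space (iid_uniform a b N).
      \<epsilon> * real N \<le> \<bar>real (card {j\<in>{1..N}. u j \<le> ?c}) - real N * y\<bar>} \<le> 2 * exp (- 2 * \<epsilon>\<^sup>2 * real N)"
    if N: "1 \<le> N" for N
  proof -
    interpret prob_space "iid_uniform a b N" by (rule prob_space_iid_uniform[OF assms(1)])
    have "(b - a) * y \<le> b - a" "0 \<le> (b - a) * y"
      using assms by (auto intro: mult_left_le)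
    then have "a \<le> ?c" "?c \<le> b" by (auto simp: linear_profile_def)
    then have c: "{a..b} \<inter> {..?c} = {a..?c}" "a \<le> ?c" by auto
    have exp: "expectation (?X j) = y" if j: "j \<in> {1..N}" for j
    proof -
      have "expectation (?X j) = (\<integral>t. indicator {..?c} t \<partial>distr (iid_uniform a b N) borel (\<lambda>u. u j))"
        by (rule integral_distr[symmetric]) (use measurable_iid_uniform_component[OF j] in auto)
      also have "\<dots> = measure (uniform_measure lborel {a..b}) {..?c}"
        unfolding distr_iid_uniform_component[OF assms(1) j] by simp
      also have "\<dots> = measure lborel {a..?c} / measure lborel {a..b}"
        using assms(1) c by (subst measure_uniform_measure) auto
      also have "\<dots> = y"
        using assms(1) c by (simp add: linear_profile_def)
      finally show ?thesis .
    qed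
    interpret Hoeffding_ineq "iid_uniform a b N" "{1..N}" ?X "\<lambda>_. 0" "\<lambda>_. 1" "real N * y"
    proof unfold_locales
      show "indep_vars (\<lambda>_. borel) ?X {1..N}"
        by (rule indep_vars_compose2[OF indep_vars_iid_uniform[OF assms(1) N]]) simp
      show "real N * y \<equiv> \<Sum>j = 1..N. expectation (?X j)"
        using exp by (intro eq_reflection) simp
    qed (auto simp: indicator_def)
    \<comment> \<open>Each indicator has range \<open>1\<close>, so the squared ranges sum to
      \<open>N\<close> and the exponent is linear in \<open>N\<close>.\<close>
    have "- 2 * (\<epsilon> * real N)\<^sup>2 / (\<Sum>j = 1..N. (1 - 0)\<^sup>2) = - 2 * \<epsilon>\<^sup>2 * real N"
      using N by (simp add: power2_eq_square)
    then show ?thesis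
      using Hoeffding_ineq_abs_ge[of "\<epsilon> * real N"] N assms(4)
      unfolding card_le_eq_sum_indicator by simp
  qed
  show "eventually (\<lambda>N. norm (measure (iid_uniform a b N) {u \<in> space (iid_uniform a b N).
      \<epsilon> * real N \<le> \<bar>real (card {j\<in>{1..N}. u j \<le> ?c}) - real N * y\<bar>}) \<le> 2 * exp (- 2 * \<epsilon>\<^sup>2 * real N)) sequentially"
    using eventually_ge_at_top[of 1] by eventually_elim (use bound in simp)
  show "(\<lambda>N. 2 * exp (- 2 * \<epsilon>\<^sup>2 * real N)) \<longlonglongrightarrow> 0"
    using assms(4) by real_asymp
qed

section \<open>Order statistics at a macroscopic rank\<close>

lemma eventually_index_le:
  assumes "0 \<le> x" "x < 1"
  shows "eventually (\<lambda>N. nat \<lfloor>x * real N\<rfloor> + k \<le> N) sequentially"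
proof -
  \<comment> \<open>As \<open>x < 1\<close>, the gap \<open>(1 - x) * N\<close> eventually exceeds
    \<open>k\<close>.\<close>
  have "eventually (\<lambda>N. x * real N + real k \<le> real N) sequentially"
    using assms by real_asymp
  then show ?thesis
  proof eventually_elim
    case (elim N)
    have "real (nat \<lfloor>x * real N\<rfloor>) \<le> x * real N" using assms by simp
    then show ?case using elim by linarith
  qed
qed

text \<open>At a level \<open>y\<close> slightly above \<open>x\<close>, the number of samples below
  the profile is about \<open>N * y\<close>, which exceeds every rank in the window by a margin
  linear in \<open>N\<close>.\<close>

lemma order_stat_upper:
  assumes ab: "a < b" and x: "0 \<le> x" "x < 1" and \<delta>: "0 < \<delta>"
  shows "\<exists>B. (\<forall>N. B N \<in> sets (iid_uniform a b N)) \<and> (\<lambda>N. measure (iid_uniform a b N) (B N)) \<longlonglongrightarrow> 0 \<and>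
    eventually (\<lambda>N. \<forall>u \<in> space (iid_uniform a b N) - B N. \<forall>j\<in>{1..k}.
       order_stat N u (nat \<lfloor>x * real N\<rfloor> + j) \<le> linear_profile a b x + \<delta>) sequentially"
proof -
  \<comment> \<open>The first entry keeps \<open>y\<close> below \<open>1\<close>, the second keeps
    the profile at \<open>y\<close> within \<open>\<delta>\<close> of that at \<open>x\<close>; both
    exceed \<open>x\<close>.\<close>
  define y where "y = min ((1 + x) / 2) (x + \<delta> / (b - a))"
  have "y \<le> (1 + x) / 2" unfolding y_def by (rule min.cobounded1)
  moreover have "x < y"
    using x divide_pos_pos[OF \<delta>, of "b - a"] ab unfolding y_def by auto
  ultimately have y: "x < y" "0 \<le> y" "y \<le> 1" using x by auto
  have "(b - a) * (y - x) \<le> (b - a) * (\<delta> / (b - a))"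
    using ab by (intro mult_left_mono) (auto simp: y_def)
  also have "\<dots> = \<delta>" using ab by simp
  finally have prof: "linear_profile a b y \<le> linear_profile a b x + \<delta>"
    by (simp add: linear_profile_def algebra_simps)
  \<comment> \<open>Half of the gap is allowed for the deviation of the count; the other half
    absorbs the offset \<open>k\<close>.\<close>
  define \<epsilon> where "\<epsilon> = (y - x) / 2"
  have \<epsilon>: "0 < \<epsilon>" using y by (simp add: \<epsilon>_def)
  define B where "B N = {u \<in> space (iid_uniform a b N).
      \<epsilon> * real N \<le> \<bar>real (card {j\<in>{1..N}. u j \<le> linear_profile a b y}) - real N * y\<bar>}" for N
  have "eventually (\<lambda>N. real k < \<epsilon> * real N) sequentially" using \<epsilon> by real_asymp
  with eventually_index_le[OF x, of k]
  have "eventually (\<lambda>N. \<forall>u \<in> space (iid_uniform a b N) - B N. \<forall>j\<in>{1..k}.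
       order_stat N u (nat \<lfloor>x * real N\<rfloor> + j) \<le> linear_profile a b x + \<delta>) sequentially"
  proof eventually_elim
    case (elim N)
    show ?case
    proof safe
      fix u j assume u: "u \<in> space (iid_uniform a b N)" "u \<notin> B N" and j: "j \<in> {1..k}"
      let ?i = "nat \<lfloor>x * real N\<rfloor> + j"
      have "real (nat \<lfloor>x * real N\<rfloor>) \<le> x * real N" using x by simp
      then have "real ?i \<le> x * real N + real k" using j by auto
      also have "\<dots> \<le> real N * y - \<epsilon> * real N" using elim by (simp add: \<epsilon>_def field_simps)
      also have "\<dots> \<le> real (card {j\<in>{1..N}. u j \<le> linear_profile a b y})"
        using u unfolding B_def by (auto simp: abs_le_iff not_le)
      finally have "?i \<le> card {j\<in>{1..N}. u j \<le> linear_profile a b y}" by simp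
      moreover have "?i \<in> {1..N}" using j elim by auto
      ultimately have "order_stat N u ?i \<le> linear_profile a b y" by (simp add: order_stat_le_iff)
      with prof show "order_stat N u ?i \<le> linear_profile a b x + \<delta>" by simp
    qed
  qed
  moreover have "B N \<in> sets (iid_uniform a b N)" for N unfolding B_def by (rule sets_card_deviation)
  moreover have "(\<lambda>N. measure (iid_uniform a b N) (B N)) \<longlonglongrightarrow> 0"
    unfolding B_def by (rule empirical_count_tendsto[OF ab y(2,3) \<epsilon>])
  ultimately show ?thesis by blast
qed

text \<open>Mirror image of the upper bound, with a level \<open>y\<close> below \<open>x\<close>:
  too few samples lie below the profile at \<open>y\<close> to reach the rank. Room for
  \<open>0 \<le> y < x\<close> requires \<open>0 < x\<close>.\<close>

lemma order_stat_lower: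
  assumes ab: "a < b" and x: "0 < x" "x < 1" and \<delta>: "0 < \<delta>"
  shows "\<exists>B. (\<forall>N. B N \<in> sets (iid_uniform a b N)) \<and> (\<lambda>N. measure (iid_uniform a b N) (B N)) \<longlonglongrightarrow> 0 \<and>
    eventually (\<lambda>N. \<forall>u \<in> space (iid_uniform a b N) - B N. \<forall>j\<in>{1..k}.
       linear_profile a b x - \<delta> \<le> order_stat N u (nat \<lfloor>x * real N\<rfloor> + j)) sequentially"
proof -
  define y where "y = max 0 (x - \<delta> / (b - a))"
  have y: "y < x" "0 \<le> y" "y \<le> 1" using x divide_pos_pos[OF \<delta>, of "b - a"] ab by (auto simp: y_def min_def max_def)
  have "(b - a) * (x - y) \<le> (b - a) * (\<delta> / (b - a))"
    using ab by (intro mult_left_mono) (auto simp: y_def)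
  also have "\<dots> = \<delta>" using ab by simp
  finally have prof: "linear_profile a b x - \<delta> \<le> linear_profile a b y"
    by (simp add: linear_profile_def algebra_simps)
  \<comment> \<open>The whole gap can be spent on the deviation, because the offset \<open>j\<close>
    only raises the rank.\<close>
  define \<epsilon> where "\<epsilon> = x - y"
  have \<epsilon>: "0 < \<epsilon>" using y by (simp add: \<epsilon>_def)
  define B where "B N = {u \<in> space (iid_uniform a b N).
      \<epsilon> * real N \<le> \<bar>real (card {j\<in>{1..N}. u j \<le> linear_profile a b y}) - real N * y\<bar>}" for N
  have "eventually (\<lambda>N. \<forall>u \<in> space (iid_uniform a b N) - B N. \<forall>j\<in>{1..k}.
       linear_profile a b x - \<delta> \<le> order_stat N u (nat \<lfloor>x * real N\<rfloor> + j)) sequentially"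
    using eventually_index_le[OF less_imp_le[OF x(1)] x(2), of k]
  proof eventually_elim
    case (elim N)
    show ?case
    proof safe
      fix u j assume u: "u \<in> space (iid_uniform a b N)" "u \<notin> B N" and j: "j \<in> {1..k}"
      let ?i = "nat \<lfloor>x * real N\<rfloor> + j"
      have "x * real N < real (nat \<lfloor>x * real N\<rfloor>) + 1"
        using x by (simp add: of_nat_nat)
      \<comment> \<open>Here \<open>j \<ge> 1\<close> matters: it compensates for the floor and
        makes the inequality strict.\<close>
      then have "x * real N < real ?i" using j by auto
      moreover have "real (card {j\<in>{1..N}. u j \<le> linear_profile a b y}) < real N * y + \<epsilon> * real N"
        using u unfolding B_def by (auto simp: abs_le_iff not_le)
      moreover have "real N * y + \<epsilon> * real N = x * real N" by (simp add: \<epsilon>_def algebra_simps)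
      ultimately have "\<not> ?i \<le> card {j\<in>{1..N}. u j \<le> linear_profile a b y}" by linarith
      moreover have "?i \<in> {1..N}" using j elim by auto
      ultimately have "\<not> order_stat N u ?i \<le> linear_profile a b y" by (simp add: order_stat_le_iff)
      with prof show "linear_profile a b x - \<delta> \<le> order_stat N u ?i" by simp
    qed
  qed
  moreover have "B N \<in> sets (iid_uniform a b N)" for N unfolding B_def by (rule sets_card_deviation)
  moreover have "(\<lambda>N. measure (iid_uniform a b N) (B N)) \<longlonglongrightarrow> 0"
    unfolding B_def by (rule empirical_count_tendsto[OF ab y(2,3) \<epsilon>])
  ultimately show ?thesis by blast
qed

lemma order_stat_close:
  assumes ab: "a < b" and x: "0 \<le> x" "x < 1" and \<delta>: "0 < \<delta>"
  shows "\<exists>B. (\<forall>N. B N \<in> sets (iid_uniform a b N)) \<and> (\<lambda>N. measure (iid_uniform a b N) (B N)) \<longlonglongrightarrow> 0 \<and>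
    eventually (\<lambda>N. AE u in iid_uniform a b N. u \<notin> B N \<longrightarrow> (\<forall>j\<in>{1..k}.
       \<bar>order_stat N u (nat \<lfloor>x * real N\<rfloor> + j) - linear_profile a b x\<bar> \<le> \<delta>)) sequentially"
proof -
  let ?\<Theta> = "\<lambda>N u j. order_stat N u (nat \<lfloor>x * real N\<rfloor> + j)"
  obtain B1 where B1: "\<And>N. B1 N \<in> sets (iid_uniform a b N)"
      "(\<lambda>N. measure (iid_uniform a b N) (B1 N)) \<longlonglongrightarrow> 0"
      "eventually (\<lambda>N. \<forall>u \<in> space (iid_uniform a b N) - B1 N. \<forall>j\<in>{1..k}.
         ?\<Theta> N u j \<le> linear_profile a b x + \<delta>) sequentially"
    using order_stat_upper[OF ab x \<delta>, of k] by blast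
  \<comment> \<open>At \<open>x = 0\<close> the count bound is vacuous, but almost surely no sample lies below the profile.\<close>
  obtain B2 where B2: "\<And>N. B2 N \<in> sets (iid_uniform a b N)"
      "(\<lambda>N. measure (iid_uniform a b N) (B2 N)) \<longlonglongrightarrow> 0"
      "eventually (\<lambda>N. AE u in iid_uniform a b N. u \<notin> B2 N \<longrightarrow> (\<forall>j\<in>{1..k}.
         linear_profile a b x - \<delta> \<le> ?\<Theta> N u j)) sequentially"
  proof (cases "x = 0")
    case True
    have "eventually (\<lambda>N. AE u in iid_uniform a b N. u \<notin> {} \<longrightarrow> (\<forall>j\<in>{1..k}.
         linear_profile a b x - \<delta> \<le> ?\<Theta> N u j)) sequentially"
      using eventually_index_le[OF x, of k]
    proof eventually_elim
      case (elim N)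
      show ?case
        using AE_iid_uniform_order_stat[OF ab, of N]
        by eventually_elim (use elim True \<delta> in \<open>force simp: linear_profile_def\<close>)
    qed
    then show ?thesis by (intro that[of "\<lambda>_. {}"]) auto
  next
    case False
    then obtain B where B: "\<And>N. B N \<in> sets (iid_uniform a b N)"
        "(\<lambda>N. measure (iid_uniform a b N) (B N)) \<longlonglongrightarrow> 0"
        "eventually (\<lambda>N. \<forall>u \<in> space (iid_uniform a b N) - B N. \<forall>j\<in>{1..k}.
           linear_profile a b x - \<delta> \<le> ?\<Theta> N u j) sequentially"
      using order_stat_lower[OF ab _ x(2) \<delta>, of k] x(1) by force
    show ?thesis
      by (rule that[OF B(1,2)]) (use B(3) in eventually_elim, auto intro!: AE_I2)
  qed
  have "(\<lambda>N. measure (iid_uniform a b N) (B1 N \<union> B2 N)) \<longlonglongrightarrow> 0"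
  proof (rule Lim_null_comparison)
    show "eventually (\<lambda>N. norm (measure (iid_uniform a b N) (B1 N \<union> B2 N))
        \<le> measure (iid_uniform a b N) (B1 N) + measure (iid_uniform a b N) (B2 N)) sequentially"
    proof (intro always_eventually allI)
      fix N
      interpret prob_space "iid_uniform a b N" by (rule prob_space_iid_uniform[OF ab])
      show "norm (prob (B1 N \<union> B2 N)) \<le> prob (B1 N) + prob (B2 N)"
        using measure_Un_le[OF B1(1) B2(1)] by simp
    qed
    show "(\<lambda>N. measure (iid_uniform a b N) (B1 N) + measure (iid_uniform a b N) (B2 N)) \<longlonglongrightarrow> 0"
      using tendsto_add[OF B1(2) B2(2)] by simp
  qed
  moreover from B1(3) B2(3)
  have "eventually (\<lambda>N. AE u in iid_uniform a b N. u \<notin> B1 N \<union> B2 N \<longrightarrow> (\<forall>j\<in>{1..k}.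
       \<bar>?\<Theta> N u j - linear_profile a b x\<bar> \<le> \<delta>)) sequentially"
  proof eventually_elim
    case (elim N)
    \<comment> \<open>The bound off \<open>B1 N\<close> holds pointwise on the space, the one off
      \<open>B2 N\<close> only almost surely; \<open>AE_space\<close> puts both under one
      quantifier.\<close>
    from elim(2) AE_space show ?case
      by eventually_elim (use elim(1) in \<open>auto simp: abs_le_iff algebra_simps\<close>)
  qed
  moreover have "\<forall>N. B1 N \<union> B2 N \<in> sets (iid_uniform a b N)" using B1(1) B2(1) by blast
  ultimately show ?thesis by (intro exI[of _ "\<lambda>N. B1 N \<union> B2 N"]) blast
qed

subsection \<open>Integrals against the mixture\<close>

text \<open>Pads the window product with factors \<open>1\<close> so that integrals over all
  \<open>N\<close> coordinates factorise. In \<open>g\<close>, the first argument is the position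
  within the window, the second the absolute coordinate.\<close>

lemma prod_window:
  fixes g :: "nat \<Rightarrow> nat \<Rightarrow> 'a :: comm_monoid_mult"
  assumes "m + k \<le> N"
  shows "(\<Prod>i\<in>{1..N}. if i \<in> {1 + m..k + m} then g (i - m) i else 1) = (\<Prod>j=1..k. g j (m + j))"
proof -
  have "(\<Prod>i\<in>{1..N}. if i \<in> {1 + m..k + m} then g (i - m) i else 1) = (\<Prod>i\<in>{1 + m..k + m}. g (i - m) i)"
    using assms by (intro prod.mono_neutral_cong_right) auto
  also have "\<dots> = (\<Prod>j=1..k. g j (m + j))"
    by (subst prod.shift_bounds_cl_nat_ivl) (simp add: add.commute)
  finally show ?thesis .
qed

lemma nn_integral_geom_product:
  fixes f :: "nat \<Rightarrow> nat \<Rightarrow> ennreal"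
  shows "(\<integral>\<^sup>+\<eta>. (\<Prod>i\<in>{1..N}. f i (\<eta> i)) \<partial>geom_product N \<theta>)
    = (\<Prod>i\<in>{1..N}. \<integral>\<^sup>+n. f i n \<partial>measure_pmf (geom_law (\<theta> i)))"
proof -
  interpret product_sigma_finite "\<lambda>i. measure_pmf (geom_law (\<theta> i))"
    by (simp add: product_sigma_finite_def measure_pmf.sigma_finite_measure_axioms)
  show ?thesis
    unfolding geom_product_def by (rule product_nn_integral_prod) auto
qed

lemma sets_geom_mixture:
  assumes "a < b"
  shows "sets (geom_mixture a b N) = sets (\<Pi>\<^sub>M i\<in>{1..N}. count_space UNIV)"
  using geom_mixture_in_prob_algebra[OF assms, of N] by (simp add: space_prob_algebra)

text \<open>Given the order statistics the coordinates are independent, so the inner integral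
  factorises into moments, and coordinates outside the window contribute \<open>1\<close>.
  Nonnegative integrals avoid any integrability question at this stage.\<close>

lemma nn_integral_geom_mixture_window:
  assumes "a < b" "m + k \<le> N"
  shows "(\<integral>\<^sup>+\<eta>. ennreal (\<Prod>j=1..k. real (\<eta> (m + j)) ^ p j) \<partial>geom_mixture a b N)
    = (\<integral>\<^sup>+u. ennreal (\<Prod>j=1..k. geom_moment (p j) (order_stat N u (m + j))) \<partial>iid_uniform a b N)"
proof -
  define f :: "nat \<Rightarrow> nat \<Rightarrow> ennreal"
    where "f i n = (if i \<in> {1 + m..k + m} then ennreal (real n ^ p (i - m)) else 1)" for i n
  have prod_f: "ennreal (\<Prod>j=1..k. real (\<eta> (m + j)) ^ p j) = (\<Prod>i\<in>{1..N}. f i (\<eta> i))" for \<eta> :: "nat \<Rightarrow> nat"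
    unfolding f_def
    by (subst prod_window[OF assms(2), where g = "\<lambda>j i. ennreal (real (\<eta> i) ^ p j)"])
       (simp add: prod_ennreal)
  have int_f: "(\<Prod>i\<in>{1..N}. \<integral>\<^sup>+n. f i n \<partial>measure_pmf (geom_law (\<theta> i)))
      = ennreal (\<Prod>j=1..k. geom_moment (p j) (\<theta> (m + j)))" for \<theta>
  proof -
    have "(\<integral>\<^sup>+n. f i n \<partial>measure_pmf (geom_law (\<theta> i)))
        = (if i \<in> {1 + m..k + m} then ennreal (geom_moment (p (i - m)) (\<theta> i)) else 1)" for i
      unfolding f_def
      by (cases "i \<in> {1 + m..k + m}")
         (simp_all only: if_True if_False nn_integral_geom_law_power nn_integral_const
           measure_pmf.emeasure_space_1 mult_1)
    then show ?thesis
      by (simp only: prod_window[OF assms(2), where g = "\<lambda>j i. ennreal (geom_moment (p j) (\<theta> i))"]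
          prod_ennreal geom_moment_nonneg)
  qed
  have kernel: "(\<lambda>u. geom_product N (order_stat N u))
      \<in> iid_uniform a b N \<rightarrow>\<^sub>M subprob_algebra (\<Pi>\<^sub>M i\<in>{1..N}. count_space UNIV)"
    unfolding measurable_cong_sets[OF sets_iid_uniform refl]
    by (rule measurable_prob_algebraD[OF measurable_geom_product])
  have "(\<lambda>\<eta>. \<Prod>i\<in>{1..N}. f i (\<eta> i)) \<in> borel_measurable (\<Pi>\<^sub>M i\<in>{1..N}. count_space UNIV)"
    by (intro borel_measurable_prod_ennreal measurable_compose[OF measurable_component_singleton]) auto
  then show ?thesis
    unfolding prod_f geom_mixture_def
    by (subst nn_integral_bind[OF _ kernel]) (simp_all only: nn_integral_geom_product int_f)
qed

section \<open>Uniform bounds and the passage to real integrals\<close>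

lemma measurable_geom_moment_order_stat:
  assumes "m + k \<le> N"
  shows "(\<lambda>u. \<Prod>j=1..k. geom_moment (p j) (order_stat N u (m + j))) \<in> borel_measurable (iid_uniform a b N)"
  unfolding measurable_cong_sets[OF sets_iid_uniform refl] using assms
  by (intro borel_measurable_prod measurable_compose[OF measurable_order_stat borel_measurable_geom_moment]) auto

lemma geom_moment_bounded:
  assumes "0 \<le> a"
  shows "\<exists>C. \<forall>\<theta>\<in>{a..b}. geom_moment p \<theta> \<le> C"
proof -
  have "continuous_on {a..b} (geom_moment p)"
    by (rule continuous_on_subset[OF continuous_on_geom_moment]) (use assms in auto)
  then have "bounded (geom_moment p ` {a..b})"
    by (intro compact_imp_bounded compact_continuous_image) auto
  then show ?thesis
    unfolding bounded_real by (metis abs_le_D1 imageI)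
qed

text \<open>The constant is chosen before \<open>m\<close> and \<open>N\<close>: it depends only on
  the maxima of the moments over the compact parameter interval.\<close>

lemma prod_geom_moment_bounded:
  assumes "0 \<le> a" "a < b"
  shows "\<exists>C. \<forall>m N. m + k \<le> N \<longrightarrow>
    (AE u in iid_uniform a b N. \<bar>\<Prod>j=1..k. geom_moment (p j) (order_stat N u (m + j))\<bar> \<le> C)"
proof -
  obtain C where C: "\<And>q \<theta>. \<theta> \<in> {a..b} \<Longrightarrow> geom_moment q \<theta> \<le> C q"
    using geom_moment_bounded[OF assms(1), of b] by metis
  have "AE u in iid_uniform a b N. \<bar>\<Prod>j=1..k. geom_moment (p j) (order_stat N u (m + j))\<bar> \<le> (\<Prod>j=1..k. C (p j))"
    if "m + k \<le> N" for m N
    using AE_iid_uniform_order_stat[OF assms(2), of N]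
  proof eventually_elim
    case (elim u)
    have "(\<Prod>j=1..k. geom_moment (p j) (order_stat N u (m + j))) \<le> (\<Prod>j=1..k. C (p j))"
      using elim that by (intro prod_mono conjI geom_moment_nonneg C) auto
    then show ?case by (simp add: prod_nonneg geom_moment_nonneg)
  qed
  then show ?thesis by blast
qed

text \<open>The moment product is almost surely bounded, so its integral is finite; the identity of
  nonnegative integrals then gives integrability of the unbounded product of the
  \<open>\<eta>\<close> and equality of the real integrals.\<close>

lemma geom_mixture_window:
  assumes "0 \<le> a" "a < b" "m + k \<le> N"
  shows "integrable (geom_mixture a b N) (\<lambda>\<eta>. \<Prod>j=1..k. real (\<eta> (m + j)) ^ p j)" (is ?int)
    and "(\<integral>\<eta>. (\<Prod>j=1..k. real (\<eta> (m + j)) ^ p j) \<partial>geom_mixture a b N)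
      = (\<integral>u. (\<Prod>j=1..k. geom_moment (p j) (order_stat N u (m + j))) \<partial>iid_uniform a b N)" (is ?eq)
proof -
  let ?g = "\<lambda>u. \<Prod>j=1..k. geom_moment (p j) (order_stat N u (m + j))"
  interpret prob_space "iid_uniform a b N" by (rule prob_space_iid_uniform[OF assms(2)])
  have meas: "(\<lambda>\<eta>. \<Prod>j=1..k. real (\<eta> (m + j)) ^ p j) \<in> borel_measurable (geom_mixture a b N)"
    unfolding measurable_cong_sets[OF sets_geom_mixture[OF assms(2)] refl] using assms(3)
    by (intro borel_measurable_prod
        measurable_compose[OF measurable_component_singleton, where g = "\<lambda>n. real n ^ p j" for j]) auto
  obtain C where "AE u in iid_uniform a b N. \<bar>?g u\<bar> \<le> C"
    using prod_geom_moment_bounded[OF assms(1,2), of k p] assms(3) by blast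
  then have "integrable (iid_uniform a b N) ?g"
    using measurable_geom_moment_order_stat[OF assms(3), of p a b]
    by (intro integrable_const_bound[where B = C]) auto
  then have "(\<integral>\<^sup>+u. ennreal (?g u) \<partial>iid_uniform a b N) = ennreal (\<integral>u. ?g u \<partial>iid_uniform a b N)"
    by (rule nn_integral_eq_integral) (simp add: prod_nonneg geom_moment_nonneg)
  then have nn: "(\<integral>\<^sup>+\<eta>. ennreal (\<Prod>j=1..k. real (\<eta> (m + j)) ^ p j) \<partial>geom_mixture a b N)
      = ennreal (\<integral>u. ?g u \<partial>iid_uniform a b N)"
    using nn_integral_geom_mixture_window[OF assms(2,3), of p] by simp
  show ?int
    using meas nn by (intro integrableI_nonneg) (auto intro!: AE_I2 prod_nonneg)
  have "0 \<le> (\<integral>u. ?g u \<partial>iid_uniform a b N)"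
    by (intro Bochner_Integration.integral_nonneg prod_nonneg ballI geom_moment_nonneg)
  then show ?eq
    using meas nn by (subst integral_eq_nn_integral) (auto intro!: AE_I2 prod_nonneg)
qed

section \<open>Passage to the limit\<close>

theorem theorem4p1:
  fixes \<theta>\<^sub>L \<theta>\<^sub>R x :: real and k :: nat and p :: "nat \<Rightarrow> nat"
  assumes "0 \<le> \<theta>\<^sub>L" and "\<theta>\<^sub>L < \<theta>\<^sub>R"
    and "k \<ge> 1" and "0 \<le> x" and "x < 1"
  shows "(\<forall>N. nat \<lfloor>x * real N\<rfloor> + k \<le> N \<longrightarrow>
            integrable (geom_mixture \<theta>\<^sub>L \<theta>\<^sub>R N)
              (\<lambda>\<eta>. \<Prod>j=1..k. real (\<eta> (nat \<lfloor>x * real N\<rfloor> + j)) ^ p j))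
       \<and> (\<lambda>N. \<integral>\<eta>. (\<Prod>j=1..k. real (\<eta> (nat \<lfloor>x * real N\<rfloor> + j)) ^ p j) \<partial>geom_mixture \<theta>\<^sub>L \<theta>\<^sub>R N)
         \<longlonglongrightarrow> (\<Prod>j=1..k. measure_pmf.expectation (geom_law (linear_profile \<theta>\<^sub>L \<theta>\<^sub>R x))
                              (\<lambda>\<xi>. real \<xi> ^ p j))"
proof (intro conjI allI impI)
  note ab = assms(1,2)
  let ?r = "linear_profile \<theta>\<^sub>L \<theta>\<^sub>R x"
  let ?i = "\<lambda>N. nat \<lfloor>x * real N\<rfloor>"
  let ?g = "\<lambda>N u. \<Prod>j=1..k. geom_moment (p j) (order_stat N u (?i N + j))"
  show "integrable (geom_mixture \<theta>\<^sub>L \<theta>\<^sub>R N) (\<lambda>\<eta>. \<Prod>j=1..k. real (\<eta> (?i N + j)) ^ p j)"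
    if "?i N + k \<le> N" for N
    by (rule geom_mixture_window(1)[OF ab that])
  have ev: "eventually (\<lambda>N. ?i N + k \<le> N) sequentially"
    by (rule eventually_index_le) fact+
  have r: "?r \<in> {0..}" using assms by (simp add: linear_profile_def)
  obtain C where C: "\<forall>m N. m + k \<le> N \<longrightarrow>
      (AE u in iid_uniform \<theta>\<^sub>L \<theta>\<^sub>R N. \<bar>\<Prod>j=1..k. geom_moment (p j) (order_stat N u (m + j))\<bar> \<le> C)"
    using prod_geom_moment_bounded[OF ab, of k p] by blast
  have "(\<lambda>N. \<integral>u. ?g N u \<partial>iid_uniform \<theta>\<^sub>L \<theta>\<^sub>R N) \<longlonglongrightarrow> (\<Prod>j=1..k. geom_moment (p j) ?r)"
  proof (rule tendsto_integral_bounded_in_probability[where C = C])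
    show "prob_space (iid_uniform \<theta>\<^sub>L \<theta>\<^sub>R N)" for N
      by (rule prob_space_iid_uniform[OF ab(2)])
    show "eventually (\<lambda>N. ?g N \<in> borel_measurable (iid_uniform \<theta>\<^sub>L \<theta>\<^sub>R N)) sequentially"
      using ev by eventually_elim (rule measurable_geom_moment_order_stat)
    show "eventually (\<lambda>N. AE u in iid_uniform \<theta>\<^sub>L \<theta>\<^sub>R N. \<bar>?g N u\<bar> \<le> C) sequentially"
      using ev by eventually_elim (use C in blast)
    fix \<epsilon> :: real assume "0 < \<epsilon>"
    \<comment> \<open>The tolerance comes from continuity of the moment product at the constant
      tuple \<open>?r\<close>; the exceptional sets below are those for this
      \<open>\<delta>\<close>.\<close>
    obtain \<delta> where \<delta>: "0 < \<delta>"
      "\<forall>t. (\<forall>j\<in>{1..k}. t j \<in> {0..} \<and> \<bar>t j - ?r\<bar> \<le> \<delta>) \<longrightarrow>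
         \<bar>(\<Prod>j=1..k. geom_moment (p j) (t j)) - (\<Prod>j=1..k. geom_moment (p j) ?r)\<bar> \<le> \<epsilon>"
      using prod_continuous_on_uniform[OF finite_atLeastAtMost continuous_on_geom_moment r \<open>0 < \<epsilon>\<close>,
          of 1 k "\<lambda>j. p j"]
      by (elim exE conjE) (rule that)
    obtain B where B: "\<forall>N. B N \<in> sets (iid_uniform \<theta>\<^sub>L \<theta>\<^sub>R N)"
        "(\<lambda>N. measure (iid_uniform \<theta>\<^sub>L \<theta>\<^sub>R N) (B N)) \<longlonglongrightarrow> 0"
        "eventually (\<lambda>N. AE u in iid_uniform \<theta>\<^sub>L \<theta>\<^sub>R N. u \<notin> B N \<longrightarrow> (\<forall>j\<in>{1..k}.
           \<bar>order_stat N u (?i N + j) - ?r\<bar> \<le> \<delta>)) sequentially"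
      using order_stat_close[OF ab(2) assms(4,5) \<delta>(1), of k] by (elim exE conjE) (rule that)
    from ev B(3) have "eventually (\<lambda>N. AE u in iid_uniform \<theta>\<^sub>L \<theta>\<^sub>R N. u \<notin> B N \<longrightarrow>
        \<bar>?g N u - (\<Prod>j=1..k. geom_moment (p j) ?r)\<bar> \<le> \<epsilon>) sequentially"
    proof eventually_elim
      case (elim N)
      note N = elim(1)
      from elim(2) AE_iid_uniform_order_stat[OF ab(2), of N] show ?case
      proof eventually_elim
        case (elim u)
        \<comment> \<open>Continuity of the moments is available only on the nonnegative half-line,
          so the order statistics must be placed there.\<close>
        have "order_stat N u (?i N + j) \<in> {0..}" if "j \<in> {1..k}" for j
        proof -
          have "?i N + j \<in> {1..N}" using that N by auto
          then have "order_stat N u (?i N + j) \<in> {\<theta>\<^sub>L..\<theta>\<^sub>R}" using elim(2) by blast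
          then show ?thesis using ab(1) by simp
        qed
        then show ?case
          using elim(1) by (intro impI \<delta>(2)[THEN spec, THEN mp]) blast
      qed
    qed
    with B(1,2) show "\<exists>B. (\<forall>N. B N \<in> sets (iid_uniform \<theta>\<^sub>L \<theta>\<^sub>R N)) \<and>
        (\<lambda>N. measure (iid_uniform \<theta>\<^sub>L \<theta>\<^sub>R N) (B N)) \<longlonglongrightarrow> 0 \<and>
        eventually (\<lambda>N. AE u in iid_uniform \<theta>\<^sub>L \<theta>\<^sub>R N. u \<notin> B N \<longrightarrow>
          \<bar>?g N u - (\<Prod>j=1..k. geom_moment (p j) ?r)\<bar> \<le> \<epsilon>) sequentially"
      by (intro exI[of _ B] conjI)
  qed
  \<comment> \<open>The two integrals are identified only once the window fits into
    \<open>{1..N}\<close>, which suffices for the limit.\<close>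
  moreover have "eventually (\<lambda>N. (\<integral>u. ?g N u \<partial>iid_uniform \<theta>\<^sub>L \<theta>\<^sub>R N)
      = (\<integral>\<eta>. (\<Prod>j=1..k. real (\<eta> (?i N + j)) ^ p j) \<partial>geom_mixture \<theta>\<^sub>L \<theta>\<^sub>R N)) sequentially"
    using ev by eventually_elim (rule geom_mixture_window(2)[OF ab, symmetric])
  ultimately show "(\<lambda>N. \<integral>\<eta>. (\<Prod>j=1..k. real (\<eta> (?i N + j)) ^ p j) \<partial>geom_mixture \<theta>\<^sub>L \<theta>\<^sub>R N)
      \<longlonglongrightarrow> (\<Prod>j=1..k. measure_pmf.expectation (geom_law ?r) (\<lambda>\<xi>. real \<xi> ^ p j))"
    unfolding geom_moment_def by (rule Lim_transform_eventually)
qed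

end
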